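(* Let $\mathcal{P}_A,\mathcal{P}_B\in(0,1)$ and let $\mathcal{G}_A=G(\mathcal{P}_A)$, $\mathcal{G}_B=G(\mathcal{P}_B)$ be the corresponding probabilities that $A$, respectively $B$, wins a game on own serve. Assume that $\mathcal{G}_A+\mathcal{G}_B>1$. Let $H$ be the number of games won by $A$ minus the number of games won by $B$ in a best-of-three sets match between $A$ and $B$, let $S_1\in\{A,B\}$ be the first server of the first set, and write $H^{\mathrm{match}}_A=\mathbb{E}(H\mid S_1=A)$ and $H^{\mathrm{match}}_B=\mathbb{E}(H\mid S_1=B)$. Then $H^{\mathrm{match}}_A>H^{\mathrm{match}}_B$.
   Context: Tennis model with constant serve-point probabilities. Two players $A,B$ play. Each point is won by the player $\sigma\in\{A,B\}$ serving it with probability $\mathcal{P}_\sigma$, independently of all other points. A (non-tiebreak) game served by $\sigma$ is won by $\sigma$ with probability $\mathcal{G}_\sigma=G(\mathcal{P}_\sigma)$, where $$G(x)=x^4\left(15-4x-\frac{10x^2}{1-2x(1-x)}\right),$$ and distinct games are independent. Set: the players alternate serving games, starting with the first server of the set. The set is won by the first player to have won at least 6 games with a lead of at least 2 games; if the score reaches 6-6 a tiebreak is played, which decides the set (final score 7-6) and counts as one game (the 13th), won by the tiebreak winner. Hence the possible final scores are 6-0, 6-1, 6-2, 6-3, 6-4, 7-5, 7-6 in favour of either player, and the total number of games is the sum of the two numbers in the score. Tiebreak: the first server of the set serves the first point of the tiebreak; then the opponent serves two points, then the first server two points, and so on alternately in blocks of two; the tiebreak is won by the first player with at least 7 points and a lead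 of at least 2 points. Match: sets (each of them, including a third set, won by the first player to have won at least 6 games with a lead of at least 2 games, or by the winner of a tiebreak if the score reaches 6-6) are played until one player has won two sets, so 2 or 3 sets are played. Alternation of serve continues across sets, a tiebreak counting as one game: if a set consists of an even number of games, its first server also serves first in the next set; if it consists of an odd number of games, the other player serves first in the next set. Given its first server, each set is independent of the preceding ones. $\mathbb{E}(\,\cdot\mid S_1=\sigma)$ means the expectation in the model for a match whose first set is started by server $\sigma$. *)

theory Defs
  imports "HOL-Probability.Probability"
begin

datatype player = A | B

fun opponent :: "player \<Rightarrow> player" where
  "opponent A = B"
| "opponent B = A"

text \<open>Winner of a contest that \<open>\<sigma>\<close> wins with probability \<open>p\<close>.\<close>

definition winner_pmf :: "player \<Rightarrow> real \<Rightarrow> player pmf" where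
  "winner_pmf \<sigma> p = map_pmf (\<lambda>w. if w then \<sigma> else opponent \<sigma>) (bernoulli_pmf p)"

text \<open>Throughout, \<open>P \<sigma>\<close> is the probability that \<open>\<sigma>\<close> wins a point on own serve.\<close>

definition game_prob :: "real \<Rightarrow> real" where
  "game_prob x = x ^ 4 * (15 - 4 * x - 10 * x ^ 2 / (1 - 2 * x * (1 - x)))"

definition game_pmf :: "(player \<Rightarrow> real) \<Rightarrow> player \<Rightarrow> player pmf" where
  "game_pmf P \<sigma> = winner_pmf \<sigma> (game_prob (P \<sigma>))"

text \<open>
  Tiebreak points are numbered from 0; point 0 is served by \<open>\<sigma>\<close>, points 1 and 2 by the
  opponent, points 3 and 4 by \<open>\<sigma>\<close>, and so on. An outcome \<open>\<omega>\<close> records the winner of every point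
  of an infinite sequence, of which the points after the end of the tiebreak are irrelevant.
\<close>

definition tiebreak_server :: "player \<Rightarrow> nat \<Rightarrow> player" where
  "tiebreak_server \<sigma> k = (if even (Suc k div 2) then \<sigma> else opponent \<sigma>)"

definition tiebreak_points :: "(player \<Rightarrow> real) \<Rightarrow> player \<Rightarrow> (nat \<Rightarrow> player) measure" where
  "tiebreak_points P \<sigma> =
     (\<Pi>\<^sub>M k\<in>UNIV. measure_pmf (winner_pmf (tiebreak_server \<sigma> k) (P (tiebreak_server \<sigma> k))))"

definition points_won :: "(nat \<Rightarrow> player) \<Rightarrow> player \<Rightarrow> nat \<Rightarrow> nat" where
  "points_won \<omega> \<tau> n = card {k. k < n \<and> \<omega> k = \<tau>}"

definition tiebreak_target :: "(nat \<Rightarrow> player) \<Rightarrow> player \<Rightarrow> nat \<Rightarrow> bool" where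
  "tiebreak_target \<omega> \<tau> n \<longleftrightarrow>
     points_won \<omega> \<tau> n \<ge> 7 \<and> points_won \<omega> \<tau> n \<ge> points_won \<omega> (opponent \<tau>) n + 2"

definition wins_tiebreak :: "(nat \<Rightarrow> player) \<Rightarrow> player \<Rightarrow> bool" where
  "wins_tiebreak \<omega> \<tau> \<longleftrightarrow>
     (\<exists>n. tiebreak_target \<omega> \<tau> n \<and> (\<forall>m<n. \<not> tiebreak_target \<omega> (opponent \<tau>) m))"

text \<open>
  For point probabilities in the open unit interval a tiebreak ends almost surely, so the
  complementary probability is that of a win of \<open>B\<close>.
\<close>

definition tiebreak_pmf :: "(player \<Rightarrow> real) \<Rightarrow> player \<Rightarrow> player pmf" where
  "tiebreak_pmf P \<sigma> = winner_pmf A (measure (tiebreak_points P \<sigma>) {\<omega>. wins_tiebreak \<omega> A})"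

text \<open>
  A score \<open>(a, b)\<close> consists of the games won by \<open>A\<close> and by \<open>B\<close>. A 13th game is played only
  at 6-6; it is the tiebreak and ends the set.
\<close>

definition set_over :: "nat \<Rightarrow> nat \<Rightarrow> bool" where
  "set_over a b \<longleftrightarrow> (a \<ge> 6 \<and> a \<ge> b + 2) \<or> (b \<ge> 6 \<and> b \<ge> a + 2) \<or> a + b \<ge> 13"

text \<open>
  Final score of a set continued from score \<open>(a, b)\<close> with \<open>\<sigma>\<close> serving next. At 6-6 twelve
  games have been played, so \<open>\<sigma>\<close> is then the first server of the set.
\<close>

function set_from :: "(player \<Rightarrow> real) \<Rightarrow> player \<Rightarrow> nat \<Rightarrow> nat \<Rightarrow> (nat \<times> nat) pmf" where
  "set_from P \<sigma> a b =
     (if set_over a b then return_pmf (a, b)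
      else bind_pmf (if a = 6 \<and> b = 6 then tiebreak_pmf P \<sigma> else game_pmf P \<sigma>)
        (\<lambda>w. if w = A then set_from P (opponent \<sigma>) (Suc a) b
             else set_from P (opponent \<sigma>) a (Suc b)))"
  by pat_completeness auto
termination
  by (relation "Wellfounded.measure (\<lambda>(P, \<sigma>, a, b). 13 - (a + b))") (auto simp: set_over_def)

declare set_from.simps [simp del]

definition tennis_set_pmf :: "(player \<Rightarrow> real) \<Rightarrow> player \<Rightarrow> (nat \<times> nat) pmf" where
  "tennis_set_pmf P \<sigma> = set_from P \<sigma> 0 0"

definition next_first_server :: "player \<Rightarrow> nat \<times> nat \<Rightarrow> player" where
  "next_first_server \<sigma> s = (if even (fst s + snd s) then \<sigma> else opponent \<sigma>)"

text \<open>
  Scores of the remaining sets of a match when \<open>A\<close> has won \<open>m\<close> sets, \<open>B\<close> has won \<open>n\<close> sets and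
  \<open>\<sigma>\<close> serves first in the next set.
\<close>

function match_from :: "(player \<Rightarrow> real) \<Rightarrow> player \<Rightarrow> nat \<Rightarrow> nat \<Rightarrow> (nat \<times> nat) list pmf" where
  "match_from P \<sigma> m n =
     (if m \<ge> 2 \<or> n \<ge> 2 then return_pmf []
      else bind_pmf (tennis_set_pmf P \<sigma>)
        (\<lambda>s. map_pmf (Cons s)
           (if fst s > snd s then match_from P (next_first_server \<sigma> s) (Suc m) n
            else match_from P (next_first_server \<sigma> s) m (Suc n))))"
  by pat_completeness auto
termination
  by (relation "Wellfounded.measure (\<lambda>(P, \<sigma>, m, n). 4 - (m + n))") auto

declare match_from.simps [simp del]

definition match_pmf :: "(player \<Rightarrow> real) \<Rightarrow> player \<Rightarrow> (nat \<times> nat) list pmf" where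
  "match_pmf P \<sigma> = match_from P \<sigma> 0 0"

definition game_difference :: "(nat \<times> nat) list \<Rightarrow> real" where
  "game_difference ss = (\<Sum>(a, b)\<leftarrow>ss. real a - real b)"

definition H_match :: "(player \<Rightarrow> real) \<Rightarrow> player \<Rightarrow> real" where
  "H_match P \<sigma> = measure_pmf.expectation (match_pmf P \<sigma>) game_difference"

end

theory Submission
  imports Defs
begin

text \<open>
  Write \<open>a\<close> and \<open>b\<close> for the probabilities that \<open>A\<close> and \<open>B\<close> win a game on own serve, so that
  \<open>a + b > 1\<close>. The point is to compare a match started by \<open>A\<close> with one started by \<open>B\<close>.

  For a single set, group the games into consecutive pairs. Each pair contains one service game of
  either player, and the order of these two games is immaterial unless the set can end between
  them. This is possible only at 5-1, 5-3, 1-5 and 3-5. At 5-1, for instance, the first server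
  matters only if each server would win the own game of the pair (final score 6-1 if \<open>A\<close> serves
  first, 6-2 if \<open>B\<close> does) or if each would lose it (6-2 and 6-1, respectively). Hence, once the
  score is 5-1, starting with \<open>A\<close> moves the probability \<open>a * b - (1 - a) * (1 - b) = a + b - 1\<close> from
  6-2 to 6-1, a gain of one game for \<open>A\<close>. At each of the other three scores \<open>A\<close> also gains one game
  with this net probability. The tiebreak contributes nothing: its serve pattern also consists of
  pairs, and within a pair it may end early only if the second point cannot change the winner. So
  for a single set
  \<^item> the winner has the same distribution for both first servers, and
  \<^item> the expected difference of games is larger by some \<open>\<delta> > 0\<close> if \<open>A\<close> serves first
    (lemmas \<open>prob_A_wins_server\<close> and \<open>games_gap_advantage\<close>).

  In the match, the set winners are therefore governed by one probability \<open>p\<close> that \<open>A\<close> wins a set,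
  whoever starts it, and the first server affects a later set only through the parity of the number
  of games of the sets before it. Let \<open>x\<close> be the probability that a set started by \<open>A\<close> is won by \<open>A\<close>
  in an even number of games, minus the probability that a set started by \<open>B\<close> is won by \<open>A\<close> in an odd
  number of games, and \<open>y\<close> the analogue for sets won by \<open>B\<close>. A set won by \<open>A\<close> passes the advantage of
  serving first on to the next set with factor \<open>x\<close>, a set won by \<open>B\<close> with factor \<open>y\<close>, and these
  factors may be negative. Summing over the courses of a match, the advantage of a match started by \<open>A\<close>
  is \<open>\<delta> * (1 + x + y + 2 * x * y)\<close>. Since \<open>\<bar>x\<bar> \<le> p\<close>, \<open>\<bar>y\<bar> \<le> 1 - p\<close> and \<open>0 < p < 1\<close>, this is
  positive (lemma \<open>transmission_factor_pos\<close>).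
\<close>

section \<open>Winning a service game\<close>

lemma game_denominator_pos: "1 - 2 * x * (1 - x) > (0 :: real)"
  using zero_le_power2[of "1 - 2 * x"] by (simp add: power2_eq_square algebra_simps)

text \<open>Over the common denominator, positivity and symmetry become polynomial facts.\<close>
lemma game_prob_fraction:
  "game_prob x = x ^ 4 * ((15 - 4 * x) * (1 - 2 * x * (1 - x)) - 10 * x\<^sup>2)
    / (1 - 2 * x * (1 - x))"
proof -
  have "x ^ 4 * (15 - 4 * x - 10 * x\<^sup>2 / d) = x ^ 4 * ((15 - 4 * x) * d - 10 * x\<^sup>2) / d"
    if "d > 0" for d :: real
    using that by (simp add: diff_divide_distrib right_diff_distrib)
  from this[OF game_denominator_pos] show ?thesis
    unfolding game_prob_def .
qed

lemma game_prob_pos: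
  assumes "x \<in> {0<..<1}"
  shows "game_prob x > 0"
proof -
  \<comment> \<open>The cubic on the right of the next step has value 1 at 1; the quadratic quotient is positive.\<close>
  have "0 < 1 + (1 - x) * (8 * (x - 5 / 4)\<^sup>2 + 3 / 2)"
    using assms by (intro add_pos_nonneg mult_nonneg_nonneg) auto
  also have "\<dots> = (15 - 4 * x) * (1 - 2 * x * (1 - x)) - 10 * x\<^sup>2"
    by (simp add: power2_eq_square algebra_simps)
  finally show ?thesis
    using assms game_denominator_pos[of x] unfolding game_prob_fraction
    by (intro divide_pos_pos mult_pos_pos) auto
qed

text \<open>
  Exchanging the chances of server and returner exchanges the chances of winning the game. This
  gives the upper bound on \<^const>\<open>game_prob\<close> from positivity.
\<close>
lemma game_prob_complement: "game_prob x + game_prob (1 - x) = 1"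
proof -
  have "1 - 2 * (1 - x) * (1 - (1 - x)) = 1 - 2 * x * (1 - x)"
    by simp
  moreover have "x ^ 4 * ((15 - 4 * x) * (1 - 2 * x * (1 - x)) - 10 * x\<^sup>2)
      + (1 - x) ^ 4 * ((15 - 4 * (1 - x)) * (1 - 2 * x * (1 - x)) - 10 * (1 - x)\<^sup>2)
      = 1 - 2 * x * (1 - x)"
    by algebra
  ultimately show ?thesis
    using game_denominator_pos[of x] unfolding game_prob_fraction
    by (simp only: add_divide_distrib[symmetric]) simp
qed

lemma game_prob_open_unit:
  assumes "x \<in> {0<..<1}"
  shows "game_prob x \<in> {0<..<1}"
  using game_prob_pos[of x] game_prob_pos[of "1 - x"] game_prob_complement[of x] assms by auto

section \<open>Fairness of the tiebreak\<close>

text \<open>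
  The points 0 and 1, 2 and 3, and so on are exchanged. The serving order ABBAABBA... then becomes
  BAABBAAB..., that of a tiebreak started by the other player.
\<close>

definition swap_pair :: "nat \<Rightarrow> nat" where
  "swap_pair k = (if even k then Suc k else k - 1)"

lemma swap_pair_involution [simp]: "swap_pair (swap_pair k) = k"
  by (auto simp: swap_pair_def elim: oddE)

lemma swap_pair_less_even: "even n \<Longrightarrow> swap_pair k < n \<longleftrightarrow> k < n"
  by (auto simp: swap_pair_def elim!: evenE oddE)

lemma tiebreak_server_swap_pair:
  "tiebreak_server \<sigma> (swap_pair k) = tiebreak_server (opponent \<sigma>) k"
proof -
  have "even (Suc (swap_pair k) div 2) \<longleftrightarrow> odd (Suc k div 2)"
    by (auto simp: swap_pair_def elim!: evenE oddE)
  moreover have "opponent (opponent \<sigma>) = \<sigma>"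
    by (cases \<sigma>) auto
  ultimately show ?thesis
    by (simp add: tiebreak_server_def)
qed

lemma points_won_swap_pair:
  assumes "even n"
  shows "points_won (\<lambda>k. \<omega> (swap_pair k)) \<tau> n = points_won \<omega> \<tau> n"
  unfolding points_won_def
  by (rule bij_betw_same_card[where f = swap_pair], rule bij_betwI[where g = swap_pair])
    (use assms in \<open>auto simp: swap_pair_less_even\<close>)

lemma points_won_Suc:
  "points_won \<omega> \<tau> (Suc n) = points_won \<omega> \<tau> n + (if \<omega> n = \<tau> then 1 else 0)"
proof -
  have "{k. k < Suc n \<and> \<omega> k = \<tau>}
      = {k. k < n \<and> \<omega> k = \<tau>} \<union> (if \<omega> n = \<tau> then {n} else {})"
    by (auto simp: less_Suc_eq)
  then show ?thesis
    by (simp add: points_won_def)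
qed

lemma points_won_sum: "points_won \<omega> \<tau> n + points_won \<omega> (opponent \<tau>) n = n"
proof (induction n)
  case (Suc n)
  then show ?case
    by (cases \<tau>; cases "\<omega> n") (auto simp: points_won_Suc)
qed (simp add: points_won_def)

text \<open>
  After an odd number of points a lead of two is a lead of at least three, so it survives the next
  point. The result of a tiebreak can therefore be read off at the even times alone, where it does
  not depend on the order of the two points of a pair.
\<close>
lemma tiebreak_target_odd_Suc:
  assumes "odd n" and "tiebreak_target \<omega> \<tau> n"
  shows "tiebreak_target \<omega> \<tau> (Suc n)"
proof -
  have "points_won \<omega> \<tau> n \<noteq> points_won \<omega> (opponent \<tau>) n + 2"
    using assms(1) points_won_sum[of \<omega> \<tau> n] by presburger
  then show ?thesis
    using assms(2) by (auto simp: tiebreak_target_def points_won_Suc)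
qed

lemma tiebreak_target_unique:
  "tiebreak_target \<omega> \<tau> n \<Longrightarrow> \<not> tiebreak_target \<omega> (opponent \<tau>) n"
  by (cases \<tau>) (auto simp: tiebreak_target_def)

lemma wins_tiebreak_iff_even:
  "wins_tiebreak \<omega> \<tau> \<longleftrightarrow>
    (\<exists>n. even n \<and> tiebreak_target \<omega> \<tau> n \<and>
      (\<forall>m<n. even m \<longrightarrow> \<not> tiebreak_target \<omega> (opponent \<tau>) m))"
proof
  assume "wins_tiebreak \<omega> \<tau>"
  then obtain n where n: "tiebreak_target \<omega> \<tau> n"
      "\<forall>m<n. \<not> tiebreak_target \<omega> (opponent \<tau>) m"
    by (auto simp: wins_tiebreak_def)
  show "\<exists>n. even n \<and> tiebreak_target \<omega> \<tau> n \<and>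
      (\<forall>m<n. even m \<longrightarrow> \<not> tiebreak_target \<omega> (opponent \<tau>) m)"
  proof (cases "even n")
    case True
    with n show ?thesis by blast
  next
    case False
    with n show ?thesis
      by (intro exI[of _ "Suc n"])
        (auto simp: less_Suc_eq intro: tiebreak_target_odd_Suc)
  qed
next
  assume "\<exists>n. even n \<and> tiebreak_target \<omega> \<tau> n \<and>
      (\<forall>m<n. even m \<longrightarrow> \<not> tiebreak_target \<omega> (opponent \<tau>) m)"
  then obtain n where n: "even n" "tiebreak_target \<omega> \<tau> n"
      "\<And>m. m < n \<Longrightarrow> even m \<Longrightarrow> \<not> tiebreak_target \<omega> (opponent \<tau>) m"
    by blast
  have "\<not> tiebreak_target \<omega> (opponent \<tau>) m" if "m < n" for m
  proof
    assume m: "tiebreak_target \<omega> (opponent \<tau>) m"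
    then have "odd m"
      using n(3) that by blast
    then have "tiebreak_target \<omega> (opponent \<tau>) (Suc m)" "even (Suc m)"
      using m tiebreak_target_odd_Suc by auto
    with n that show False
      by (metis Suc_lessI tiebreak_target_unique)
  qed
  with n(2) show "wins_tiebreak \<omega> \<tau>"
    by (auto simp: wins_tiebreak_def)
qed

lemma wins_tiebreak_swap_pair:
  "wins_tiebreak (\<lambda>k. \<omega> (swap_pair k)) \<tau> = wins_tiebreak \<omega> \<tau>"
  unfolding wins_tiebreak_iff_even
  by (simp add: tiebreak_target_def points_won_swap_pair cong: conj_cong imp_cong)

text \<open>
  The events do not depend on the point probabilities, so measurability is shown once for the
  product of the discrete spaces.
\<close>
lemma sets_tiebreak_points:
  "sets (tiebreak_points P \<sigma>) = sets (\<Pi>\<^sub>M k\<in>UNIV. count_space UNIV)"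
  unfolding tiebreak_points_def by (rule sets_PiM_cong) auto

lemma space_tiebreak_points [simp]: "space (tiebreak_points P \<sigma>) = UNIV"
  by (simp add: tiebreak_points_def space_PiM)

lemma measurable_points_won [measurable]:
  "(\<lambda>\<omega>. points_won \<omega> \<tau> n) \<in> measurable (\<Pi>\<^sub>M k\<in>UNIV. count_space UNIV) (count_space UNIV)"
proof (induction n)
  case 0
  then show ?case by (simp add: points_won_def)
next
  case (Suc n)
  note Suc [measurable]
  show ?case unfolding points_won_Suc by measurable
qed

lemma sets_wins_tiebreak:
  "{\<omega>. wins_tiebreak \<omega> \<tau>} \<in> sets (tiebreak_points P \<sigma>)"
proof -
  have "{\<omega> \<in> space (\<Pi>\<^sub>M k\<in>UNIV. count_space UNIV). wins_tiebreak \<omega> \<tau>}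
      \<in> sets (\<Pi>\<^sub>M k\<in>UNIV. count_space UNIV)"
    unfolding wins_tiebreak_def tiebreak_target_def by measurable
  then show ?thesis
    by (simp add: sets_tiebreak_points space_PiM)
qed

text \<open>
  Exchanging the two points of every pair maps the point sequences of one serving order to those of
  the other, preserving both the probabilities and the winner.
\<close>
lemma tiebreak_pmf_opponent: "tiebreak_pmf P (opponent \<sigma>) = tiebreak_pmf P \<sigma>"
proof -
  let ?M = "\<lambda>k. measure_pmf (winner_pmf (tiebreak_server \<sigma> k) (P (tiebreak_server \<sigma> k)))"
  let ?f = "\<lambda>\<omega> k. \<omega> (swap_pair k) :: player"
  let ?W = "{\<omega>. wins_tiebreak \<omega> A}"
  have "inj swap_pair"
    by (metis injI swap_pair_involution)
  then have distr: "distr (tiebreak_points P \<sigma>) (tiebreak_points P (opponent \<sigma>)) ?f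
      = tiebreak_points P (opponent \<sigma>)"
    using distr_PiM_reindex[of UNIV ?M swap_pair UNIV]
    by (simp add: tiebreak_points_def tiebreak_server_swap_pair measure_pmf.prob_space_axioms restrict_UNIV)
  have meas: "?f \<in> measurable (tiebreak_points P \<sigma>) (tiebreak_points P (opponent \<sigma>))"
    unfolding tiebreak_points_def
    by (rule measurable_PiM_single') auto
  have "measure (tiebreak_points P (opponent \<sigma>)) ?W
      = measure (tiebreak_points P \<sigma>) (?f -` ?W \<inter> space (tiebreak_points P \<sigma>))"
    by (subst distr[symmetric], rule measure_distr[OF meas sets_wins_tiebreak])
  also have "?f -` ?W \<inter> space (tiebreak_points P \<sigma>) = ?W"
    by (auto simp: wins_tiebreak_swap_pair)
  finally show ?thesis
    by (simp add: tiebreak_pmf_def)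
qed

section \<open>Expectations over a single set\<close>

lemma expectation_bind_winner_pmf:
  fixes h :: "'a \<Rightarrow> real"
  assumes "p \<in> {0..1}" and "\<And>w. finite (set_pmf (g w))"
  shows "measure_pmf.expectation (bind_pmf (winner_pmf \<sigma> p) g) h
    = p * measure_pmf.expectation (g \<sigma>) h
      + (1 - p) * measure_pmf.expectation (g (opponent \<sigma>)) h"
  using assms unfolding winner_pmf_def bind_map_pmf
  by (subst pmf_expectation_bind[of UNIV]) (auto simp: UNIV_bool)

lemma set_from_over: "set_over i j \<Longrightarrow> set_from P \<sigma> i j = return_pmf (i, j)"
  by (subst set_from.simps) (simp only: if_True)

lemma set_from_not_over:
  "\<not> set_over i j \<Longrightarrow> set_from P \<sigma> i j =
    bind_pmf (if i = 6 \<and> j = 6 then tiebreak_pmf P \<sigma> else game_pmf P \<sigma>)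
      (\<lambda>w. if w = A then set_from P (opponent \<sigma>) (Suc i) j
            else set_from P (opponent \<sigma>) i (Suc j))"
  by (subst set_from.simps) (simp only: if_False)

lemma finite_players: "finite (S :: player set)"
  by (rule finite_subset[of _ "{A, B}"]) (auto intro: player.exhaust)

lemma finite_set_pmf_set_from: "finite (set_pmf (set_from P \<sigma> i j))"
proof (induction "13 - (i + j)" arbitrary: \<sigma> i j rule: less_induct)
  case less
  show ?case
  proof (cases "set_over i j")
    case True
    then show ?thesis by (simp add: set_from_over)
  next
    case False
    then have "13 - (Suc i + j) < 13 - (i + j)" "13 - (i + Suc j) < 13 - (i + j)"
      by (auto simp: set_over_def)
    then have "finite (set_pmf (set_from P \<sigma>' (Suc i) j))"
        "finite (set_pmf (set_from P \<sigma>' i (Suc j)))" for \<sigma>'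
      by (auto intro: less)
    then show ?thesis
      unfolding set_from_not_over[OF False] set_bind_pmf
      by (intro finite_UN_I finite_players) simp
  qed
qed

lemma finite_set_pmf_match_from: "finite (set_pmf (match_from P \<sigma> m n))"
proof (induction P \<sigma> m n rule: match_from.induct)
  case (1 P \<sigma> m n)
  then show ?case
    by (subst match_from.simps) (auto simp: tennis_set_pmf_def finite_set_pmf_set_from)
qed

definition set_mean ::
  "(player \<Rightarrow> real) \<Rightarrow> player \<Rightarrow> nat \<Rightarrow> nat \<Rightarrow> (nat \<times> nat \<Rightarrow> real) \<Rightarrow> real" where
  "set_mean P \<sigma> i j f = measure_pmf.expectation (set_from P \<sigma> i j) f"

definition server_gap ::
  "(player \<Rightarrow> real) \<Rightarrow> nat \<Rightarrow> nat \<Rightarrow> (nat \<times> nat \<Rightarrow> real) \<Rightarrow> real" where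
  "server_gap P i j f = set_mean P A i j f - set_mean P B i j f"

lemma set_mean_over: "set_over i j \<Longrightarrow> set_mean P \<sigma> i j f = f (i, j)"
  by (simp add: set_mean_def set_from_over)

lemma server_gap_over: "set_over i j \<Longrightarrow> server_gap P i j f = 0"
  by (simp add: server_gap_def set_mean_over)

text \<open>At 6-6 only the tiebreak remains, which favours neither server.\<close>
lemma server_gap_tiebreak: "server_gap P 6 6 f = 0"
proof -
  have over: "set_over 7 6" "set_over 6 7" "\<not> set_over 6 6"
    by (auto simp: set_over_def)
  have "set_from P \<sigma> 6 6
      = bind_pmf (tiebreak_pmf P \<sigma>) (\<lambda>w. return_pmf (if w = A then (7, 6) else (6, 7)))" for \<sigma>
    using over
    by (auto simp: set_from_not_over set_from_over intro!: bind_pmf_cong)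
  moreover have "tiebreak_pmf P B = tiebreak_pmf P A"
    using tiebreak_pmf_opponent[of P A] by simp
  ultimately show ?thesis
    by (simp add: server_gap_def set_mean_def)
qed

lemma set_mean_0_0: "set_mean P \<sigma> 0 0 f = measure_pmf.expectation (tennis_set_pmf P \<sigma>) f"
  by (simp add: set_mean_def tennis_set_pmf_def)

lemma set_mean_add: "set_mean P \<sigma> i j (\<lambda>s. f s + g s) = set_mean P \<sigma> i j f + set_mean P \<sigma> i j g"
  unfolding set_mean_def
  by (intro Bochner_Integration.integral_add integrable_measure_pmf_finite finite_set_pmf_set_from)

lemma set_mean_mult_right: "set_mean P \<sigma> i j (\<lambda>s. f s * c) = set_mean P \<sigma> i j f * c"
  unfolding set_mean_def by simp

lemma set_mean_uminus: "set_mean P \<sigma> i j (\<lambda>s. - f s) = - set_mean P \<sigma> i j f"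
  unfolding set_mean_def by simp

lemma set_mean_of_bool:
  "set_mean P \<sigma> i j (\<lambda>s. of_bool (Q s)) = measure_pmf.prob (set_from P \<sigma> i j) {s. Q s}"
proof -
  have "(\<lambda>s. of_bool (Q s)) = (indicator {s. Q s} :: _ \<Rightarrow> real)"
    by (auto simp: indicator_def)
  then show ?thesis
    by (simp add: set_mean_def)
qed

section \<open>The effect of the first server on a set\<close>

locale serve_advantage =
  fixes P :: "player \<Rightarrow> real"
  assumes point_prob: "P \<sigma> \<in> {0<..<1}"
    and advantage: "game_prob (P A) + game_prob (P B) > 1"
begin

abbreviation a :: real where "a \<equiv> game_prob (P A)"
abbreviation b :: real where "b \<equiv> game_prob (P B)"

lemma game_probs: "0 < a" "a < 1" "0 < b" "b < 1"
  using game_prob_open_unit[OF point_prob] by auto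

lemma set_mean_game_A:
  assumes "\<not> set_over i j" and "i \<noteq> 6 \<or> j \<noteq> 6"
  shows "set_mean P A i j f = a * set_mean P B (Suc i) j f + (1 - a) * set_mean P B i (Suc j) f"
  using assms(2) game_probs unfolding set_mean_def set_from_not_over[OF assms(1)]
  by (auto simp: game_pmf_def expectation_bind_winner_pmf finite_set_pmf_set_from)

lemma set_mean_game_B:
  assumes "\<not> set_over i j" and "i \<noteq> 6 \<or> j \<noteq> 6"
  shows "set_mean P B i j f = b * set_mean P A i (Suc j) f + (1 - b) * set_mean P A (Suc i) j f"
  using assms(2) game_probs unfolding set_mean_def set_from_not_over[OF assms(1)]
  by (auto simp: game_pmf_def expectation_bind_winner_pmf finite_set_pmf_set_from)

text \<open>
  If the set cannot end after the next game, the next two games lead to the same distribution of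
  scores whoever serves first, and the server is then the same as before.
\<close>
lemma server_gap_two_games:
  assumes "\<not> set_over (Suc i) j" and "\<not> set_over i (Suc j)"
  shows "server_gap P i j f = a * (1 - b) * server_gap P (i + 2) j f
    + (a * b + (1 - a) * (1 - b)) * server_gap P (i + 1) (j + 1) f
    + (1 - a) * b * server_gap P i (j + 2) f"
proof -
  have "\<not> set_over i j" "i \<noteq> 6 \<or> j \<noteq> 6" "Suc i \<noteq> 6 \<or> j \<noteq> 6" "i \<noteq> 6 \<or> Suc j \<noteq> 6"
    using assms by (auto simp: set_over_def)
  with assms show ?thesis
    by (simp add: server_gap_def set_mean_game_A set_mean_game_B algebra_simps)
qed

text \<open>
  Here \<open>A\<close> wins the set with one more game. The first server matters if both players would win, or
  both would lose, their own service game; the difference of these two probabilities is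
  \<open>a * b - (1 - a) * (1 - b) = a + b - 1\<close>. The set continues only if \<open>A\<close> loses both games.
\<close>
lemma server_gap_set_point_A:
  assumes "j \<le> 3"
  shows "server_gap P 5 j f
    = (a + b - 1) * (f (6, j) - f (6, Suc j)) + (1 - a) * b * server_gap P 5 (j + 2) f"
proof -
  have "\<not> set_over 5 j" "\<not> set_over 5 (Suc j)" "set_over 6 j" "set_over 6 (Suc j)"
    using assms by (auto simp: set_over_def)
  then show ?thesis
    by (simp add: server_gap_def set_mean_game_A set_mean_game_B set_mean_over algebra_simps)
qed

lemma server_gap_set_point_B:
  assumes "i \<le> 3"
  shows "server_gap P i 5 f
    = (a + b - 1) * (f (Suc i, 6) - f (i, 6)) + a * (1 - b) * server_gap P (i + 2) 5 f"
proof -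
  have "\<not> set_over i 5" "\<not> set_over (Suc i) 5" "set_over i 6" "set_over (Suc i) 6"
    using assms by (auto simp: set_over_def)
  then show ?thesis
    by (simp add: server_gap_def set_mean_game_A set_mean_game_B set_mean_over algebra_simps)
qed

text \<open>
  It suffices that \<open>f\<close> values a shorter win of \<open>A\<close> at least as much as a win that is longer by one
  game, and a shorter loss at most as much as a longer one: these are the only exchanges of final
  scores caused by a change of the first server. Between two pairs of games the total of the score
  is even, hence the assumption on \<open>i + j\<close>.
\<close>
lemma server_gap_nonneg:
  assumes "\<And>j. j \<le> 3 \<Longrightarrow> f (6, Suc j) \<le> f (6, j)"
    and "\<And>i. i \<le> 3 \<Longrightarrow> f (i, 6) \<le> f (Suc i, 6)"
    and "even (i + j)" "i \<le> 6" "j \<le> 6"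
  shows "0 \<le> server_gap P i j f"
  using assms(3-5)
proof (induction "12 - (i + j)" arbitrary: i j rule: less_induct)
  case less
  have IH: "0 \<le> server_gap P i' j' f"
    if "i' + j' = i + j + 2" "i + j < 12" "i' \<le> 6" "j' \<le> 6" for i' j'
    using that less.prems by (intro less.hyps) auto
  consider "set_over i j" | "i = 6" "j = 6" | "i = 5" "j \<le> 3" | "j = 5" "i \<le> 3"
    | "i \<le> 4" "j \<le> 4" | "i = 5" "j = 5"
  proof -
    have "set_over i j \<or> (i = 6 \<and> j = 6) \<or> (i = 5 \<and> j \<le> 3) \<or> (j = 5 \<and> i \<le> 3)
        \<or> (i \<le> 4 \<and> j \<le> 4) \<or> (i = 5 \<and> j = 5)"
      using less.prems unfolding set_over_def by presburger
    with that show ?thesis by blast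
  qed
  then show ?case
  proof cases
    case 1
    then show ?thesis by (simp add: server_gap_over)
  next
    case 2
    then show ?thesis by (simp add: server_gap_tiebreak)
  next
    case 3
    have "0 \<le> (a + b - 1) * (f (6, j) - f (6, Suc j)) + (1 - a) * b * server_gap P 5 (j + 2) f"
      using 3 game_probs advantage assms(1)[of j]
      by (intro add_nonneg_nonneg mult_nonneg_nonneg IH) auto
    with 3 server_gap_set_point_A[of j f] show ?thesis
      by simp
  next
    case 4
    have "0 \<le> (a + b - 1) * (f (Suc i, 6) - f (i, 6)) + a * (1 - b) * server_gap P (i + 2) 5 f"
      using 4 game_probs advantage assms(2)[of i]
      by (intro add_nonneg_nonneg mult_nonneg_nonneg IH) auto
    with 4 server_gap_set_point_B[of i f] show ?thesis
      by simp
  next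
    case 5
    then have "\<not> set_over (Suc i) j" "\<not> set_over i (Suc j)"
      by (auto simp: set_over_def)
    then show ?thesis
      unfolding server_gap_two_games[of i j f, OF \<open>\<not> set_over (Suc i) j\<close> \<open>\<not> set_over i (Suc j)\<close>]
      using 5 game_probs by (intro add_nonneg_nonneg mult_nonneg_nonneg IH) auto
  next
    case 6
    have over: "set_over 7 5" "set_over 5 7" "\<not> set_over 6 5" "\<not> set_over 5 6"
      by (auto simp: set_over_def)
    with server_gap_two_games[of 5 5 f] 6 show ?thesis
      by (simp add: server_gap_over server_gap_tiebreak)
  qed
qed

text \<open>
  A function that does not distinguish the exchanged final scores, such as a function of the winner
  alone, satisfies these conditions together with its negative.
\<close>
lemma server_gap_eq_0:
  assumes "\<And>j. j \<le> 3 \<Longrightarrow> f (6, Suc j) = f (6, j)"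
    and "\<And>i. i \<le> 3 \<Longrightarrow> f (i, 6) = f (Suc i, 6)"
  shows "server_gap P 0 0 f = 0"
proof -
  have "0 \<le> server_gap P 0 0 f" "0 \<le> server_gap P 0 0 (\<lambda>s. - f s)"
    using assms by (auto intro!: server_gap_nonneg)
  then show ?thesis
    by (simp add: server_gap_def set_mean_uminus)
qed

text \<open>
  A strict preference for 6-3 over 6-4 is enough, since a set passes through 5-3 with positive
  probability: by way of 3-3, reached from 0-0 by pairs of games that are split.
\<close>
lemma server_gap_pos:
  assumes "\<And>j. j \<le> 3 \<Longrightarrow> f (6, Suc j) \<le> f (6, j)"
    and "\<And>i. i \<le> 3 \<Longrightarrow> f (i, 6) \<le> f (Suc i, 6)"
    and "f (6, 4) < f (6, 3)"
  shows "0 < server_gap P 0 0 f"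
proof -
  note nonneg = server_gap_nonneg[of f, OF assms(1,2)]
  have "0 < (a + b - 1) * (f (6, 3) - f (6, 4))"
    using advantage assms(3) by simp
  moreover have "0 \<le> (1 - a) * b * server_gap P 5 5 f"
    using game_probs by (intro mult_nonneg_nonneg nonneg) auto
  ultimately have "0 < server_gap P 5 3 f"
    using server_gap_set_point_A[of 3 f] by simp
  then have "0 < a * (1 - b) * server_gap P 5 3 f"
    using game_probs by simp
  moreover have "0 \<le> (a * b + (1 - a) * (1 - b)) * server_gap P 4 4 f"
      "0 \<le> (1 - a) * b * server_gap P 3 5 f"
    using game_probs by (intro mult_nonneg_nonneg add_nonneg_nonneg nonneg; simp)+
  ultimately have base: "0 < server_gap P 3 3 f"
    using server_gap_two_games[of 3 3 f] by (simp add: set_over_def)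
  have step: "0 < server_gap P i i f" if "0 < server_gap P (Suc i) (Suc i) f" "i \<le> 2" for i
  proof -
    have "0 < (a * b + (1 - a) * (1 - b)) * server_gap P (Suc i) (Suc i) f"
      using game_probs that(1) by (intro mult_pos_pos add_pos_pos) auto
    moreover have "0 \<le> a * (1 - b) * server_gap P (i + 2) i f"
        "0 \<le> (1 - a) * b * server_gap P i (i + 2) f"
      using game_probs that(2) by (intro mult_nonneg_nonneg nonneg; simp)+
    ultimately show ?thesis
      using server_gap_two_games[of i i f] that(2) by (simp add: set_over_def)
  qed
  have "0 < server_gap P 2 2 f"
    using step[of 2] base by simp
  then have "0 < server_gap P 1 1 f"
    using step[of 1] by (simp add: numeral_2_eq_2)
  then show ?thesis
    using step[of 0] by simp
qed

section \<open>Winner and length of a set\<close>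

abbreviation A_wins :: "nat \<times> nat \<Rightarrow> bool" where "A_wins s \<equiv> fst s > snd s"

abbreviation games_gap :: "nat \<times> nat \<Rightarrow> real" where "games_gap s \<equiv> real (fst s) - real (snd s)"

abbreviation prob_set :: "player \<Rightarrow> (nat \<times> nat \<Rightarrow> bool) \<Rightarrow> real" where
  "prob_set \<sigma> Q \<equiv> measure_pmf.prob (tennis_set_pmf P \<sigma>) {s. Q s}"

abbreviation even_games :: "nat \<times> nat \<Rightarrow> bool" where "even_games s \<equiv> even (fst s + snd s)"

lemma prob_set_mean: "set_mean P \<sigma> 0 0 (\<lambda>s. of_bool (Q s)) = prob_set \<sigma> Q"
  by (simp add: set_mean_of_bool tennis_set_pmf_def)

lemma games_gap_advantage: "0 < server_gap P 0 0 games_gap"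
  by (rule server_gap_pos) auto

lemma prob_A_wins_server: "prob_set A A_wins = prob_set B A_wins"
proof -
  have "server_gap P 0 0 (\<lambda>s. of_bool (A_wins s)) = 0"
    by (rule server_gap_eq_0) auto
  then show ?thesis
    by (simp add: server_gap_def prob_set_mean)
qed

lemma prob_B_wins: "prob_set \<sigma> (\<lambda>s. \<not> A_wins s) = 1 - prob_set \<sigma> A_wins"
  using measure_pmf.prob_compl[of "{s. A_wins s}" "tennis_set_pmf P \<sigma>"]
  by (simp add: Compl_eq_Diff_UNIV[symmetric] Collect_neg_eq)

text \<open>
  Both players can win a set, since both can win six games in a row. This excludes the degenerate
  case in which one player is certain to win every set.
\<close>
lemma set_pmf_game: "set_pmf (game_pmf P \<sigma>) = UNIV"
proof -
  have "game_prob (P \<sigma>) \<in> {0<..<1}"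
    by (rule game_prob_open_unit[OF point_prob])
  then have "set_pmf (game_pmf P \<sigma>) = {\<sigma>, opponent \<sigma>}"
    by (auto simp: game_pmf_def winner_pmf_def)
  also have "\<dots> = UNIV"
    by (cases \<sigma>) (auto intro: player.exhaust)
  finally show ?thesis .
qed

lemma love_set_A: "i \<le> 6 \<Longrightarrow> (6, 0) \<in> set_pmf (set_from P \<sigma> i 0)"
proof (induction i arbitrary: \<sigma> rule: inc_induct)
  case base
  then show ?case
    by (simp add: set_from_over set_over_def)
next
  case (step i)
  then have "\<not> set_over i 0"
    by (simp add: set_over_def)
  then show ?case
    using step by (auto simp: set_from_not_over set_pmf_game)
qed

lemma love_set_B: "j \<le> 6 \<Longrightarrow> (0, 6) \<in> set_pmf (set_from P \<sigma> 0 j)"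
proof (induction j arbitrary: \<sigma> rule: inc_induct)
  case base
  then show ?case
    by (simp add: set_from_over set_over_def)
next
  case (step j)
  then have "\<not> set_over 0 j"
    by (simp add: set_over_def)
  then show ?case
    using step by (auto simp: set_from_not_over set_pmf_game intro!: bexI[of _ B])
qed

lemma prob_A_wins_open_unit: "0 < prob_set \<sigma> A_wins" "prob_set \<sigma> A_wins < 1"
proof -
  show "0 < prob_set \<sigma> A_wins"
    using love_set_A[of 0 \<sigma>] by (intro measure_pmf_posI[of "(6, 0)"]) (auto simp: tennis_set_pmf_def)
  have "0 < prob_set \<sigma> (\<lambda>s. \<not> A_wins s)"
    using love_set_B[of 0 \<sigma>] by (intro measure_pmf_posI[of "(0, 6)"]) (auto simp: tennis_set_pmf_def)
  then show "prob_set \<sigma> A_wins < 1"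
    by (simp add: prob_B_wins)
qed

section \<open>From one set to the next\<close>

text \<open>
  For sets with outcome \<open>W\<close>, this is the factor with which the effect of the first server is passed
  on to the following set. It is negative if such sets tend to have an odd number of games. Although
  \<open>A\<close> and \<open>B\<close> enter differently, exchanging them does not change the value if \<open>W\<close> has the same
  probability for both first servers.
\<close>

definition transmission :: "(nat \<times> nat \<Rightarrow> bool) \<Rightarrow> real" where
  "transmission W = prob_set A (\<lambda>s. W s \<and> even_games s) - prob_set B (\<lambda>s. W s \<and> odd (fst s + snd s))"

lemma prob_set_split:
  "prob_set \<sigma> W
    = prob_set \<sigma> (\<lambda>s. W s \<and> even_games s) + prob_set \<sigma> (\<lambda>s. W s \<and> odd (fst s + snd s))"
  unfolding prob_set_mean[symmetric] set_mean_add[symmetric]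
  by (intro arg_cong[where f = "set_mean P \<sigma> 0 0"]) auto

lemma transmission_bound:
  assumes "prob_set A W = prob_set B W"
  shows "\<bar>transmission W\<bar> \<le> prob_set A W"
proof -
  have "0 \<le> prob_set \<sigma> Q" for \<sigma> Q
    by simp
  from this[of A "\<lambda>s. W s \<and> even_games s"] this[of A "\<lambda>s. W s \<and> odd (fst s + snd s)"]
    this[of B "\<lambda>s. W s \<and> even_games s"] this[of B "\<lambda>s. W s \<and> odd (fst s + snd s)"]
  show ?thesis
    using prob_set_split[of A W] prob_set_split[of B W] assms
    unfolding transmission_def by linarith
qed

text \<open>
  Here \<open>x \<tau>\<close> is the value of the rest of a match whose next set is started by \<open>\<tau>\<close>. As \<open>W\<close> is
  equally likely for both first servers, what the choice of the first server adds to the weight of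
  \<open>x A\<close> it takes from the weight of \<open>x B\<close>.
\<close>
lemma continuation_gap:
  assumes "prob_set A W = prob_set B W"
  shows "set_mean P A 0 0 (\<lambda>s. of_bool (W s) * x (next_first_server A s))
      - set_mean P B 0 0 (\<lambda>s. of_bool (W s) * x (next_first_server B s))
    = transmission W * (x A - x B)"
proof -
  have "set_mean P \<sigma> 0 0 (\<lambda>s. of_bool (W s) * x (next_first_server \<sigma> s))
      = prob_set \<sigma> (\<lambda>s. W s \<and> even_games s) * x \<sigma>
        + prob_set \<sigma> (\<lambda>s. W s \<and> odd (fst s + snd s)) * x (opponent \<sigma>)" for \<sigma>
  proof -
    have "(\<lambda>s. of_bool (W s) * x (next_first_server \<sigma> s))
        = (\<lambda>s. of_bool (W s \<and> even_games s) * x \<sigma>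
            + of_bool (W s \<and> odd (fst s + snd s)) * x (opponent \<sigma>))"
      by (auto simp: next_first_server_def)
    then show ?thesis
      by (simp only: set_mean_add set_mean_mult_right prob_set_mean)
  qed
  note expand = this
  have "prob_set A (\<lambda>s. W s \<and> even_games s)
      = transmission W + prob_set B (\<lambda>s. W s \<and> odd (fst s + snd s))"
    by (simp add: transmission_def)
  moreover from this have "prob_set A (\<lambda>s. W s \<and> odd (fst s + snd s))
      = prob_set B (\<lambda>s. W s \<and> even_games s) - transmission W"
    using assms prob_set_split[of A W] prob_set_split[of B W] by linarith
  ultimately show ?thesis
    by (simp only: expand opponent.simps) (simp add: algebra_simps)
qed

section \<open>Matches\<close>

definition match_mean :: "player \<Rightarrow> nat \<Rightarrow> nat \<Rightarrow> real" where
  "match_mean \<sigma> m n = measure_pmf.expectation (match_from P \<sigma> m n) game_difference"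

lemma match_mean_over: "m \<ge> 2 \<or> n \<ge> 2 \<Longrightarrow> match_mean \<sigma> m n = 0"
  unfolding match_mean_def by (subst match_from.simps) (simp add: game_difference_def)

lemma match_mean_not_over:
  assumes "m < 2" "n < 2"
  shows "match_mean \<sigma> m n = set_mean P \<sigma> 0 0 games_gap
    + set_mean P \<sigma> 0 0 (\<lambda>s. of_bool (A_wins s) * match_mean (next_first_server \<sigma> s) (Suc m) n)
    + set_mean P \<sigma> 0 0 (\<lambda>s. of_bool (\<not> A_wins s) * match_mean (next_first_server \<sigma> s) m (Suc n))"
proof -
  let ?rest = "\<lambda>s. if A_wins s then match_from P (next_first_server \<sigma> s) (Suc m) n
    else match_from P (next_first_server \<sigma> s) m (Suc n)"
  let ?S = "set_pmf (tennis_set_pmf P \<sigma>)"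
  have fin: "finite ?S"
    by (simp add: tennis_set_pmf_def finite_set_pmf_set_from)
  have rest: "measure_pmf.expectation (map_pmf (Cons s) (?rest s)) game_difference
      = games_gap s + of_bool (A_wins s) * match_mean (next_first_server \<sigma> s) (Suc m) n
        + of_bool (\<not> A_wins s) * match_mean (next_first_server \<sigma> s) m (Suc n)" for s
  proof -
    have "measure_pmf.expectation (map_pmf (Cons s) (?rest s)) game_difference
        = measure_pmf.expectation (?rest s) (\<lambda>ss. games_gap s + game_difference ss)"
      by (simp add: game_difference_def case_prod_unfold)
    also have "\<dots> = games_gap s + measure_pmf.expectation (?rest s) game_difference"
      by (subst Bochner_Integration.integral_add)
        (auto intro!: integrable_measure_pmf_finite simp: finite_set_pmf_match_from)
    finally show ?thesis
      by (auto simp: match_mean_def)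
  qed
  have "match_mean \<sigma> m n = (\<Sum>s\<in>?S. pmf (tennis_set_pmf P \<sigma>) s
      * measure_pmf.expectation (map_pmf (Cons s) (?rest s)) game_difference)"
    using assms fin unfolding match_mean_def
    by (subst match_from.simps, subst if_not_P, simp, subst pmf_expectation_bind[of ?S])
      (auto simp: finite_set_pmf_match_from)
  also have "\<dots> = set_mean P \<sigma> 0 0
      (\<lambda>s. measure_pmf.expectation (map_pmf (Cons s) (?rest s)) game_difference)"
    using fin unfolding set_mean_0_0 by (subst integral_measure_pmf[of ?S]) auto
  finally show ?thesis
    unfolding rest set_mean_add .
qed

definition match_gap :: "nat \<Rightarrow> nat \<Rightarrow> real" where
  "match_gap m n = match_mean A m n - match_mean B m n"

lemma prob_B_wins_server: "prob_set A (\<lambda>s. \<not> A_wins s) = prob_set B (\<lambda>s. \<not> A_wins s)"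
  by (simp only: prob_B_wins prob_A_wins_server)

lemma match_gap_over: "m \<ge> 2 \<or> n \<ge> 2 \<Longrightarrow> match_gap m n = 0"
  by (simp add: match_gap_def match_mean_over)

lemma match_gap_not_over:
  assumes "m < 2" "n < 2"
  shows "match_gap m n = server_gap P 0 0 games_gap + transmission A_wins * match_gap (Suc m) n
    + transmission (\<lambda>s. \<not> A_wins s) * match_gap m (Suc n)"
  using continuation_gap[OF prob_A_wins_server, of "\<lambda>\<sigma>. match_mean \<sigma> (Suc m) n"]
    continuation_gap[OF prob_B_wins_server, of "\<lambda>\<sigma>. match_mean \<sigma> m (Suc n)"]
  unfolding match_gap_def match_mean_not_over[OF assms] server_gap_def
  by linarith

text \<open>
  Twice the claimed expression is \<open>1 + u * v\<close> with \<open>u = 1 + 2 * x\<close> and \<open>v = 1 + 2 * y\<close>. A product of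
  opposite signs is smallest at one of the two corners \<open>(-p, 1 - p)\<close> and \<open>(p, p - 1)\<close> of the range of
  \<open>(x, y)\<close>, where \<open>1 + u * v\<close> is \<open>4 * (1 - p)\<^sup>2\<close> and \<open>4 * p\<^sup>2\<close>.
\<close>
lemma transmission_factor_pos:
  fixes p x y :: real
  assumes "0 < p" "p < 1" "\<bar>x\<bar> \<le> p" "\<bar>y\<bar> \<le> 1 - p"
  shows "0 < 1 + x + y + 2 * x * y"
proof -
  let ?u = "1 + 2 * x" and ?v = "1 + 2 * y"
  consider "0 \<le> ?u * ?v" | "?u < 0" "0 < ?v" | "0 < ?u" "?v < 0"
    by (metis mult_eq_0_iff mult_neg_neg mult_pos_pos less_eq_real_def linorder_neqE_linordered_idom)
  then have "- 1 < ?u * ?v"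
  proof cases
    case 1
    then show ?thesis by linarith
  next
    case 2
    have "- ?u * ?v \<le> (2 * p - 1) * (3 - 2 * p)"
      using 2 assms by (intro mult_mono) auto
    also have "\<dots> = 1 - 4 * (1 - p)\<^sup>2"
      by (simp add: power2_eq_square algebra_simps)
    also have "\<dots> < 1"
      using assms(2) by simp
    finally show ?thesis by (simp add: algebra_simps)
  next
    case 3
    have "?u * - ?v \<le> (1 + 2 * p) * (1 - 2 * p)"
      using 3 assms by (intro mult_mono) auto
    also have "\<dots> = 1 - 4 * p\<^sup>2"
      by (simp add: power2_eq_square algebra_simps)
    also have "\<dots> < 1"
      using assms(1) by simp
    finally show ?thesis by (simp add: algebra_simps)
  qed
  then show ?thesis
    by (simp add: algebra_simps)
qed

lemma match_gap_pos: "0 < match_gap 0 0"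
proof -
  let ?\<delta> = "server_gap P 0 0 games_gap"
  let ?x = "transmission A_wins" and ?y = "transmission (\<lambda>s. \<not> A_wins s)"
  have 1: "match_gap 1 1 = ?\<delta>"
    by (simp add: match_gap_not_over match_gap_over)
  have "match_gap 1 0 = ?\<delta> + ?y * match_gap 1 1" "match_gap 0 1 = ?\<delta> + ?x * match_gap 1 1"
    by (subst match_gap_not_over; simp add: match_gap_over)+
  moreover have "match_gap 0 0 = ?\<delta> + ?x * match_gap 1 0 + ?y * match_gap 0 1"
    by (subst match_gap_not_over) simp_all
  ultimately have "match_gap 0 0 = ?\<delta> * (1 + ?x + ?y + 2 * ?x * ?y)"
    unfolding 1 by (simp add: algebra_simps)
  moreover have "0 < 1 + ?x + ?y + 2 * ?x * ?y"
    using prob_A_wins_open_unit[of A] transmission_bound[OF prob_A_wins_server]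
      transmission_bound[OF prob_B_wins_server]
    unfolding prob_B_wins by (rule transmission_factor_pos)
  ultimately show ?thesis
    using games_gap_advantage by simp
qed

end

theorem proposition3p3:
  fixes P :: "player \<Rightarrow> real"
  assumes "P A \<in> {0<..<1}" and "P B \<in> {0<..<1}"
    and "game_prob (P A) + game_prob (P B) > 1"
  shows "H_match P A > H_match P B"
proof -
  interpret serve_advantage P
  proof
    show "P \<sigma> \<in> {0<..<1}" for \<sigma>
      using assms(1,2) by (cases \<sigma>) auto
  qed (rule assms(3))
  from match_gap_pos show ?thesis
    by (simp add: match_gap_def match_mean_def H_match_def match_pmf_def)
qed

end
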